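(* Suppose that a sequence $\{\rho^n\}\subset K$ converges weakly to $\rho$ in $L^1(\mathbb{R}^d)$ and that $\{M_b(\rho^n)\}$ is bounded. Then $M_b(\rho)$ is finite, and $$\liminf_{n\to\infty}W_A(\rho_0,\rho^n)^2\ge W_A(\rho_0,\rho)^2\qquad\text{for all }\rho_0\in K.$$
   Context: $A(x)$, $x\in\mathbb{R}^d$, is a smooth matrix-valued function with symmetric positive definite values; $B(x)=A(x)^{-1}$ satisfies $B(x)\ge c_0I$ for some $c_0>0$ and $B(x)=(\nabla_xb(x))^\top(\nabla_xb(x))$ for a smooth injective map $b:\mathbb{R}^d\to\mathbb{R}^q$ with $b(0)=0$, $q\ge d$. $M_b(\rho):=\int|b(x)|^2\rho(x)\,dx$, and $K$ is the set of measurable $\rho:\mathbb{R}^d\to[0,\infty)$ with $\int\rho\,dx=1$ and $M_b(\rho)<\infty$. The weighted Wasserstein distance $W_A(\rho,\tilde\rho)\ge0$ of $\rho,\tilde\rho\in K$ is given by $$W_A(\rho,\tilde\rho)^2=\min_{\pi}\int_{\mathbb{R}^d\times\mathbb{R}^d}|b(x)-b(y)|^2\,d\pi(x,y),$$ the minimum being over Borel probability measures $\pi$ on $\mathbb{R}^d\times\mathbb{R}^d$ with first marginal $\rho\,dx$ and second marginal $\tilde\rho\,dx$. *)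

theory Defs
  imports "HOL-Probability.Probability"
begin

text \<open>\<open>C_k k f\<close>: all directional derivatives of \<open>f\<close> exist (in the Frechet sense) up to order \<open>k\<close>
  and are continuous.\<close>

fun C_k :: "nat \<Rightarrow> ('a::euclidean_space \<Rightarrow> 'b::euclidean_space) \<Rightarrow> bool" where
  "C_k 0 f \<longleftrightarrow> continuous_on UNIV f"
| "C_k (Suc k) f \<longleftrightarrow>
     (\<forall>x. f differentiable (at x)) \<and> (\<forall>v. C_k k (\<lambda>x. frechet_derivative f (at x) v))"

definition smooth :: "('a::euclidean_space \<Rightarrow> 'b::euclidean_space) \<Rightarrow> bool" where
  "smooth f \<longleftrightarrow> (\<forall>k. C_k k f)"

definition sym_pos_def :: "real^'d^'d \<Rightarrow> bool" where
  "sym_pos_def M \<longleftrightarrow> transpose M = M \<and> (\<forall>v. v \<noteq> 0 \<longrightarrow> v \<bullet> (M *v v) > 0)"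

text \<open>The Bochner integral of a non-integrable function is 0, so finiteness of \<open>M_b b \<rho>\<close> is
  expressed separately, as integrability of the integrand.\<close>

definition finite_M_b :: "(real^'d \<Rightarrow> real^'q) \<Rightarrow> (real^'d \<Rightarrow> real) \<Rightarrow> bool" where
  "finite_M_b b \<rho> \<longleftrightarrow> integrable lebesgue (\<lambda>x. (norm (b x))\<^sup>2 * \<rho> x)"

definition M_b :: "(real^'d \<Rightarrow> real^'q) \<Rightarrow> (real^'d \<Rightarrow> real) \<Rightarrow> real" where
  "M_b b \<rho> = (\<integral>x. (norm (b x))\<^sup>2 * \<rho> x \<partial>lebesgue)"

definition K :: "(real^'d \<Rightarrow> real^'q) \<Rightarrow> (real^'d \<Rightarrow> real) set" where
  "K b = {\<rho>. \<rho> \<in> borel_measurable lebesgue \<and> (\<forall>x. 0 \<le> \<rho> x) \<and>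
             integrable lebesgue \<rho> \<and> (\<integral>x. \<rho> x \<partial>lebesgue) = 1 \<and> finite_M_b b \<rho>}"

text \<open>The measure \<open>\<rho> dx\<close>, restricted from the Lebesgue to the Borel sigma-algebra.\<close>

definition density_borel :: "(real^'d \<Rightarrow> real) \<Rightarrow> (real^'d) measure" where
  "density_borel \<rho> = distr (density lebesgue (\<lambda>x. ennreal (\<rho> x))) borel (\<lambda>x. x)"

definition couplings ::
    "(real^'d \<Rightarrow> real) \<Rightarrow> (real^'d \<Rightarrow> real) \<Rightarrow> ((real^'d) \<times> (real^'d)) measure set" where
  "couplings \<rho> \<rho>' = {\<pi>. sets \<pi> = sets borel \<and> prob_space \<pi> \<and>
      distr \<pi> borel fst = density_borel \<rho> \<and> distr \<pi> borel snd = density_borel \<rho>'}"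

definition transport_cost ::
    "(real^'d \<Rightarrow> real^'q) \<Rightarrow> ((real^'d) \<times> (real^'d)) measure \<Rightarrow> ennreal" where
  "transport_cost b \<pi> = (\<integral>\<^sup>+ (x, y). ennreal ((norm (b x - b y))\<^sup>2) \<partial>\<pi>)"

text \<open>\<open>LEAST\<close> is the minimum (not merely the infimum) of the set of costs.  That minimum is finite
  for densities in \<open>K b\<close> (up to null sets), so that \<open>enn2real\<close> loses nothing.\<close>

definition W_A :: "(real^'d \<Rightarrow> real^'q) \<Rightarrow> (real^'d \<Rightarrow> real) \<Rightarrow> (real^'d \<Rightarrow> real) \<Rightarrow> real" where
  "W_A b \<rho> \<rho>' = sqrt (enn2real (LEAST c. c \<in> transport_cost b ` couplings \<rho> \<rho>'))"

definition ess_bounded :: "(real^'d \<Rightarrow> real) \<Rightarrow> bool" where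
  "ess_bounded \<phi> \<longleftrightarrow>
     \<phi> \<in> borel_measurable lebesgue \<and> (\<exists>C. AE x in lebesgue. \<bar>\<phi> x\<bar> \<le> C)"

text \<open>Weak convergence in \<open>L\<^sup>1\<close>, i.e. tested against the dual space \<open>L\<^sup>\<infinity>\<close>.\<close>

definition weakly_converges_L1 ::
    "(nat \<Rightarrow> real^'d \<Rightarrow> real) \<Rightarrow> (real^'d \<Rightarrow> real) \<Rightarrow> bool" where
  "weakly_converges_L1 f g \<longleftrightarrow>
     (\<forall>n. integrable lebesgue (f n)) \<and> integrable lebesgue g \<and>
     (\<forall>\<phi>. ess_bounded \<phi> \<longrightarrow>
        (\<lambda>n. \<integral>x. f n x * \<phi> x \<partial>lebesgue) \<longlonglongrightarrow> (\<integral>x. g x * \<phi> x \<partial>lebesgue))"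

end

theory Submission
  imports Defs
begin

text \<open>
  The second moment of the limit is finite by testing the weak convergence against truncations of
  \<open>|b|\<^sup>2\<close> (\<open>finite_M_b_weak_limit\<close>).  The lower semicontinuity rests on compactness: optimal couplings
  of \<open>\<rho>0\<close> and \<open>\<rho>s n\<close> subconverge to a coupling of \<open>\<rho>0\<close> and \<open>\<rho>\<close>, the cost
  \<open>|b x - b y|\<^sup>2\<close> is continuous and nonnegative and hence has a lower semicontinuous integral, so the
  limit coupling costs at most the lower limit of the optimal costs, and the optimal coupling of
  \<open>\<rho>0\<close> and \<open>\<rho>\<close> costs no more (\<open>transport_cost_limit\<close>).  The same compactness, applied to a minimizing
  sequence, shows that minimal costs are attained (\<open>optimal_coupling_exists\<close>).

  The compactness statement is \<open>coupling_subsequence_limit\<close>.  It is reduced to Helly's selection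
  theorem on the real line.  A pair \<open>(x, y)\<close> is coded by a real number whose ternary digits, all 0
  or 1, record to which members of a countable basis \<open>x\<close> belongs (even positions) and to which \<open>y\<close>
  belongs (odd positions).  The codes lie in a Cantor set, on which every digit is the restriction
  of a continuous function on the line.  The laws of the codes have a weakly convergent
  subsequence with limit \<open>N\<close>, and it remains to decode \<open>N\<close> into a measure on pairs.  Here it is
  essential that the marginals converge against all bounded Borel functions: the law
  under \<open>N\<close> of the even digits is therefore exactly that of the code of a point distributed
  according to the limit marginal, and likewise for the odd digits, so that the digits of
  \<open>N\<close>-almost every real are those of a pair (\<open>decode_marginal\<close>).  For the semicontinuity, a continuous cost is an
  increasing limit of functions of finitely many digits (\<open>continuous_sup_of_boxes\<close>).
\<close>

section \<open>Coding points by ternary digits\<close>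

text \<open>On the two intervals that contain all codes, \<open>t \<le> 1/6\<close> (leading digit 0) and \<open>t \<ge> 1/3\<close> (leading
digit 1), this is the leading digit; the linear interpolation in between makes it continuous on
the whole line.\<close>

definition ramp :: "real \<Rightarrow> real" where
  "ramp t = max 0 (min 1 (6 * t - 1))"

fun digit :: "nat \<Rightarrow> real \<Rightarrow> real" where
  "digit 0 t = ramp t"
| "digit (Suc k) t = digit k (3 * t - ramp t)"

definition ternary :: "(nat \<Rightarrow> real) \<Rightarrow> real" where
  "ternary s = (\<Sum>k. s k / 3 ^ Suc k)"

lemma summable_third_powers: "summable (\<lambda>k. 1 / 3 ^ Suc k :: real)"
  using summable_geometric[of "1/3::real", THEN summable_divide, of 3]
  by (simp add: power_one_over field_simps)

lemma suminf_third_powers: "(\<Sum>k. 1 / 3 ^ Suc k :: real) = 1 / 2"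
  using suminf_geometric[of "1/3::real"] suminf_divide[OF summable_geometric[of "1/3::real"], of 3]
  by (simp add: power_one_over field_simps)

lemma summable_ternary:
  assumes "\<And>k. s k \<in> {0..1}"
  shows "summable (\<lambda>k. s k / 3 ^ Suc k :: real)"
proof (rule summable_comparison_test'[OF summable_third_powers, of 0])
  fix n show "norm (s n / 3 ^ Suc n) \<le> 1 / 3 ^ Suc n"
    using assms[of n] by (simp add: divide_right_mono)
qed

text \<open>The bound \<open>1/2\<close> is what opens the gap: a code with leading digit 0 is at most \<open>1/6\<close>, one with
leading digit 1 at least \<open>1/3\<close>.\<close>

lemma ternary_bounds:
  assumes "\<And>k. s k \<in> {0..1}"
  shows "ternary s \<in> {0..1/2}"
proof -
  have "0 \<le> ternary s"
    unfolding ternary_def using assms by (intro suminf_nonneg summable_ternary) auto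
  moreover have "ternary s \<le> (\<Sum>k. 1 / 3 ^ Suc k)"
    unfolding ternary_def using assms
    by (intro suminf_le summable_ternary summable_third_powers) (auto intro!: divide_right_mono)
  ultimately show ?thesis by (simp add: suminf_third_powers del: power_Suc)
qed

lemma ternary_shift:
  assumes "\<And>k. s k \<in> {0..1}"
  shows "ternary s = (s 0 + ternary (\<lambda>k. s (Suc k))) / 3"
proof -
  have "(\<Sum>k. s (Suc k) / 3 ^ Suc (Suc k)) = ternary s - s 0 / 3"
    using suminf_split_head[OF summable_ternary[of s, OF assms]] by (simp add: ternary_def)
  moreover have "(\<Sum>k. s (Suc k) / 3 ^ Suc (Suc k)) = ternary (\<lambda>k. s (Suc k)) / 3"
    using suminf_divide[OF summable_ternary[of "\<lambda>k. s (Suc k)", OF assms], of 3]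
    by (simp add: ternary_def field_simps)
  ultimately show ?thesis by (simp add: field_simps)
qed

text \<open>Reading a 0-1 sequence off its code: subtracting the leading digit from \<open>3 * t\<close> gives the code of
the shifted sequence.\<close>

lemma digit_ternary:
  assumes "\<And>k. s k \<in> {0, 1}"
  shows "digit k (ternary s) = s k"
  using assms
proof (induction k arbitrary: s)
  case (0 s)
  have s01: "s k \<in> {0..1}" for k using 0[of k] by auto
  have "ternary (\<lambda>k. s (Suc k)) \<in> {0..1/2}" by (rule ternary_bounds) (rule s01)
  then show ?case
    using 0[of 0] ternary_shift[of s, OF s01] by (auto simp: ramp_def)
next
  case (Suc k s)
  have s01: "s k \<in> {0..1}" for k using Suc.prems[of k] by auto
  have t: "ternary (\<lambda>k. s (Suc k)) \<in> {0..1/2}" by (rule ternary_bounds) (rule s01)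
  have "ramp (ternary s) = s 0"
    using t Suc.prems[of 0] ternary_shift[of s, OF s01] by (auto simp: ramp_def)
  moreover have "3 * ternary s = s 0 + ternary (\<lambda>k. s (Suc k))"
    using ternary_shift[of s, OF s01] by simp
  ultimately have "3 * ternary s - ramp (ternary s) = ternary (\<lambda>k. s (Suc k))"
    by linarith
  then show ?case using Suc.IH[of "\<lambda>k. s (Suc k)"] Suc.prems by simp
qed

lemma continuous_on_ramp [continuous_intros]:
  "continuous_on A f \<Longrightarrow> continuous_on A (\<lambda>x. ramp (f x))"
  unfolding ramp_def by (intro continuous_intros)

lemma continuous_on_digit: "continuous_on A f \<Longrightarrow> continuous_on A (\<lambda>x. digit k (f x))"
proof (induction k arbitrary: f)
  case (Suc k f)
  show ?case unfolding digit.simps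
    by (rule Suc.IH) (intro continuous_intros Suc.prems)
qed (simp add: continuous_on_ramp)

lemma digit_bounds: "digit k t \<in> {0..1}"
  by (induction k arbitrary: t) (auto simp: ramp_def)

lemma measurable_digit [measurable]: "digit k \<in> borel_measurable borel"
  using continuous_on_digit[OF continuous_on_id] by (rule borel_measurable_continuous_onI)

lemma continuous_on_ternary:
  assumes "\<And>k. continuous_on A (\<lambda>x. s x k)" and "\<And>x k. x \<in> A \<Longrightarrow> s x k \<in> {0..1}"
  shows "continuous_on A (\<lambda>x. ternary (s x))"
  unfolding ternary_def
proof (rule uniform_limit_theorem)
  show "uniform_limit A (\<lambda>n x. \<Sum>k<n. s x k / 3 ^ Suc k) (\<lambda>x. \<Sum>k. s x k / 3 ^ Suc k) sequentially"
    using assms(2) by (intro Weierstrass_m_test[OF _ summable_third_powers])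
      (auto intro!: divide_right_mono)
  show "\<forall>\<^sub>F n in sequentially. continuous_on A (\<lambda>x. \<Sum>k<n. s x k / 3 ^ Suc k)"
    by (intro always_eventually allI continuous_intros assms(1)) auto
qed simp

text \<open>The code of the sequence of answers to the questions "is \<open>x\<close> in \<open>U i\<close>?".\<close>

definition encode :: "(nat \<Rightarrow> 'a set) \<Rightarrow> 'a \<Rightarrow> real" where
  "encode U x = ternary (\<lambda>i. indicator (U i) x)"

lemma digit_encode: "digit i (encode U x) = indicator (U i) x"
  unfolding encode_def by (rule digit_ternary) (auto simp: indicator_def)

lemma measurable_encode:
  assumes [measurable]: "\<And>i. U i \<in> sets M"
  shows "encode U \<in> borel_measurable M"
  unfolding encode_def[abs_def] ternary_def by measurable

text \<open>Codes with respect to a countable basis determine the point, and measurably so: at scale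
\<open>1 / (n + 1)\<close> choose the first basic set of at most that diameter whose digit is 1, take a fixed
point of it, and let \<open>n\<close> tend to infinity.  Completeness of the space serves the measurability of
the pointwise limit at reals that are not codes.\<close>

lemma measurable_decoder_exists:
  fixes U :: "nat \<Rightarrow> 'a :: {banach, second_countable_topology} set"
  assumes "topological_basis (range U)"
  obtains D where "D \<in> borel_measurable borel" and "\<And>x. D (encode U x) = x"
proof -
  define small where "small n i \<longleftrightarrow> (\<forall>x\<in>U i. \<forall>y\<in>U i. dist x y \<le> 1 / real (Suc n))" for n i
  define pick where "pick n t = (LEAST i. small n i \<and> digit i t = 1)" for n t
  define pt where "pt i = (SOME x. x \<in> U i)" for i
  define D where "D t = lim (\<lambda>n. pt (pick n t))" for t
  have [measurable]: "pick n \<in> borel \<rightarrow>\<^sub>M count_space UNIV" for n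
    unfolding pick_def by measurable
  have [measurable]: "(\<lambda>t. pt (pick n t)) \<in> borel_measurable borel" for n
    by (rule measurable_compose_countable[where f = "\<lambda>i t. pt i"]) measurable
  have "D \<in> borel_measurable borel"
    unfolding D_def by measurable
  moreover have "D (encode U x) = x" for x
  proof -
    have near: "dist (pt (pick n (encode U x))) x \<le> 1 / real (Suc n)" for n
    proof -
      obtain i where i: "x \<in> U i" "U i \<subseteq> ball x (1 / (2 * real (Suc n)))"
        using topological_basisE[OF assms open_ball, of x x "1 / (2 * real (Suc n))"] by auto
      have "small n i" unfolding small_def
      proof (intro ballI)
        fix y z assume "y \<in> U i" "z \<in> U i"
        then have "dist x y < 1 / (2 * real (Suc n))" "dist x z < 1 / (2 * real (Suc n))"
          using i by auto
        then have "dist y z \<le> 1 / (2 * real (Suc n)) + 1 / (2 * real (Suc n))"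
          using dist_triangle3[of y z x] by linarith
        also have "\<dots> = 1 / real (Suc n)" by (simp add: field_simps)
        finally show "dist y z \<le> 1 / real (Suc n)" .
      qed
      then have "small n i \<and> digit i (encode U x) = 1"
        using i by (simp add: digit_encode)
      then have "small n (pick n (encode U x)) \<and> digit (pick n (encode U x)) (encode U x) = 1"
        unfolding pick_def by (rule LeastI)
      then have s: "small n (pick n (encode U x))" and x: "x \<in> U (pick n (encode U x))"
        by (auto simp: digit_encode indicator_def split: if_splits)
      have "pt (pick n (encode U x)) \<in> U (pick n (encode U x))"
        unfolding pt_def using x by (rule someI)
      with s x show ?thesis unfolding small_def by blast
    qed
    have "(\<lambda>n. pt (pick n (encode U x))) \<longlonglongrightarrow> x"
    proof (rule metric_LIMSEQ_I)
      fix r :: real assume "r > 0"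
      then obtain N where "inverse (real (Suc N)) < r" using reals_Archimedean by blast
      then have "dist (pt (pick n (encode U x))) x < r" if "n \<ge> N" for n
        using near[of n] that
        by (smt (verit, best) frac_le inverse_eq_divide of_nat_0_less_iff of_nat_mono Suc_le_mono zero_less_Suc)
      then show "\<exists>N. \<forall>n\<ge>N. dist (pt (pick n (encode U x))) x < r" by blast
    qed
    then show ?thesis unfolding D_def by (rule limI)
  qed
  ultimately show thesis by (rule that)
qed

lemma countable_basis_sequence:
  obtains U :: "nat \<Rightarrow> 'a :: second_countable_topology set" where "topological_basis (range U)"
proof -
  obtain B :: "'a set set" where B: "countable B" "topological_basis B"
    using ex_countable_basis by blast
  have "B \<noteq> {}"
    using topological_basisE[OF B(2) open_UNIV, of undefined] by auto
  then have "range (from_nat_into B) = B"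
    using B(1) by (rule range_from_nat_into)
  with B(2) show thesis using that[of "from_nat_into B"] by simp
qed

text \<open>If \<open>E\<close> has, under \<open>N\<close>, the law of the code of a \<open>\<mu>\<close>-distributed point, then almost every value of
\<open>E\<close> is a code, and decoding it gives a random point \<open>X\<close> with law exactly \<open>\<mu>\<close>: no mass is lost to
reals that are not codes.\<close>

lemma decode_marginal:
  fixes U :: "nat \<Rightarrow> 'a :: {banach, second_countable_topology} set"
  assumes "real_distribution N"
    and U: "topological_basis (range U)"
    and \<mu>: "sets \<mu> = sets borel"
    and E [measurable]: "E \<in> borel_measurable borel"
    and law: "distr N borel E = distr \<mu> borel (encode U)"
    and digits: "AE t in N. \<forall>i. digit i (E t) = digit (u i) t"
  obtains X where "X \<in> borel_measurable borel" and "distr N borel X = \<mu>"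
    and "AE t in N. \<forall>i. digit (u i) t = indicator (U i) (X t)"
proof -
  interpret N: real_distribution N by fact
  obtain D where D [measurable]: "D \<in> borel_measurable borel" and De: "\<And>x. D (encode U x) = x"
    using measurable_decoder_exists[OF U] by blast
  have "open (U i)" for i using U by (auto dest: topological_basis_open)
  then have e [measurable]: "encode U \<in> borel_measurable borel"
    by (intro measurable_encode) auto
  note \<mu> [measurable_cong]
  show thesis
  proof
    show "D \<circ> E \<in> borel_measurable borel" by measurable
    have "distr N borel (D \<circ> E) = distr (distr N borel E) borel D"
      by (subst distr_distr) auto
    also have "\<dots> = distr \<mu> borel (D \<circ> encode U)"
      unfolding law by (subst distr_distr) auto
    also have "\<dots> = \<mu>"
      using \<mu> by (simp add: comp_def De distr_id2)
    finally show "distr N borel (D \<circ> E) = \<mu>" .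
    have "AE s in distr \<mu> borel (encode U). encode U (D s) = s"
      by (subst AE_distr_iff) (auto simp: De)
    then have "AE t in N. encode U (D (E t)) = E t"
      unfolding law[symmetric] by (subst (asm) AE_distr_iff) auto
    with digits show "AE t in N. \<forall>i. digit (u i) t = indicator (U i) ((D \<circ> E) t)"
      by eventually_elim (metis comp_apply digit_encode)
  qed
qed

section \<open>Continuous functions as suprema of weighted boxes\<close>

text \<open>Written as a recursion so that continuity follows by induction.\<close>

fun running_max :: "(nat \<Rightarrow> real) \<Rightarrow> nat \<Rightarrow> real" where
  "running_max f 0 = f 0"
| "running_max f (Suc m) = max (running_max f m) (f (Suc m))"

lemma running_max_upper: "k \<le> m \<Longrightarrow> f k \<le> running_max f m"
  by (induction m) (auto simp: le_Suc_eq)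

lemma running_max_least: "(\<And>k. f k \<le> C) \<Longrightarrow> running_max f m \<le> C"
  by (induction m) auto

lemma running_max_mono: "(\<And>k. f k \<le> g k) \<Longrightarrow> running_max f m \<le> running_max g m"
  by (induction m) (auto simp: max.coboundedI1 max.coboundedI2)

lemma incseq_running_max: "incseq (running_max f)"
  by (rule incseq_SucI) simp

lemma continuous_on_running_max:
  "(\<And>k. continuous_on A (\<lambda>x. f x k)) \<Longrightarrow> continuous_on A (\<lambda>x. running_max (f x) m)"
  by (induction m) (auto intro!: continuous_intros)

text \<open>Enumerate all rational numbers \<open>q \<ge> 0\<close> together with all basic boxes on which \<open>c \<ge> q\<close>.  Membership in
a basic box is a product of two digits of the code of the pair, so that finite maxima of these
functions can be tested against weak limits of codes.\<close>

lemma continuous_sup_of_boxes: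
  fixes c :: "'a::topological_space \<times> 'b::topological_space \<Rightarrow> real"
  assumes U: "topological_basis (range U)" and V: "topological_basis (range V)"
    and cont: "continuous_on UNIV c" and nonneg: "\<And>z. 0 \<le> c z"
  obtains w :: "nat \<Rightarrow> real" and i j :: "nat \<Rightarrow> nat"
  where "\<And>k. 0 \<le> w k"
    and "\<And>k x y. w k * indicator (U (i k)) x * indicator (V (j k)) y \<le> c (x, y)"
    and "\<And>x y r. r < c (x, y) \<Longrightarrow> \<exists>k. r < w k * indicator (U (i k)) x * indicator (V (j k)) y"
proof -
  define q :: "nat \<Rightarrow> real" where "q k = of_rat (from_nat (fst (prod_decode k)))" for k
  define i where "i k = fst (prod_decode (snd (prod_decode k)))" for k
  define j where "j k = snd (prod_decode (snd (prod_decode k)))" for k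
  define ok where "ok k \<longleftrightarrow> 0 \<le> q k \<and> (\<forall>z \<in> U (i k) \<times> V (j k). q k \<le> c z)" for k
  define w where "w k = (if ok k then q k else 0)" for k
  show thesis
  proof (rule that[of w i j])
    show "0 \<le> w k" for k by (simp add: w_def ok_def)
    show "w k * indicator (U (i k)) x * indicator (V (j k)) y \<le> c (x, y)" for k x y
      using nonneg[of "(x, y)"] by (auto simp: w_def ok_def indicator_def)
    fix x y r assume r: "r < c (x, y)"
    show "\<exists>k. r < w k * indicator (U (i k)) x * indicator (V (j k)) y"
    proof (cases "r < 0")
      case True
      then show ?thesis by (intro exI[of _ 0]) (auto simp: w_def ok_def indicator_def)
    next
      case False
      obtain p where p: "r < of_rat p" "of_rat p < c (x, y)"
        using of_rat_dense[OF r] by auto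
      have "open {z. of_rat p < c z}"
        by (intro open_Collect_less continuous_on_const cont)
      then obtain S T where ST: "open S" "open T" "(x, y) \<in> S \<times> T" "S \<times> T \<subseteq> {z. of_rat p < c z}"
        using p(2) by (elim open_prod_elim[of _ "(x, y)"]) auto
      obtain a where a: "x \<in> U a" "U a \<subseteq> S"
        using topological_basisE[OF U ST(1)] ST(3) by blast
      obtain b where b: "y \<in> V b" "V b \<subseteq> T"
        using topological_basisE[OF V ST(2)] ST(3) by blast
      define k where "k = prod_encode (to_nat p, prod_encode (a, b))"
      have k: "q k = of_rat p" "i k = a" "j k = b"
        by (simp_all add: q_def i_def j_def k_def)
      have "(0::real) \<le> of_rat p" using p(1) False by linarith
      then have "ok k"
        unfolding ok_def k using a b ST(4) by (auto intro!: less_imp_le simp del: zero_le_of_rat_iff)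
      then have "r < w k * indicator (U (i k)) x * indicator (V (j k)) y"
        using p a b by (simp add: w_def k)
      then show ?thesis ..
    qed
  qed
qed

section \<open>Limits of laws on the line\<close>

text \<open>Helly's selection theorem; tightness is automatic on a bounded interval.\<close>

lemma unit_supported_subsequence_limit:
  assumes "\<And>n. real_distribution (M n)" and "\<And>n. AE t in M n. t \<in> {0..1}"
  obtains r :: "nat \<Rightarrow> nat" and N where "strict_mono r" "real_distribution N"
    and "\<And>f C. continuous_on UNIV f \<Longrightarrow> (\<And>t. \<bar>f t :: real\<bar> \<le> C) \<Longrightarrow>
           (\<lambda>n. \<integral>t. f t \<partial>M (r n)) \<longlonglongrightarrow> (\<integral>t. f t \<partial>N)"
proof -
  have mass: "measure (M n) {-1<..1} = 1" for n
  proof -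
    interpret real_distribution "M n" by fact
    have "AE t in M n. t \<in> {-1<..1}" using assms(2)[of n] by eventually_elim auto
    then show ?thesis by (subst prob_eq_1) auto
  qed
  have "tight M"
    unfolding tight_def
  proof (intro conjI allI impI assms(1))
    fix \<epsilon> :: real assume "\<epsilon> > 0"
    then show "\<exists>a b. a < b \<and> (\<forall>n. 1 - \<epsilon> < measure (M n) {a<..b})"
      using mass by (intro exI[of _ "-1"] exI[of _ 1]) auto
  qed
  then obtain r N where r: "strict_mono (r :: nat \<Rightarrow> nat)" "real_distribution N"
      "weak_conv_m (M \<circ> id \<circ> r) N"
    using tight_imp_convergent_subsubsequence[of M id] by (auto simp: strict_mono_id)
  show thesis
  proof (rule that[OF r(1,2)])
    fix f :: "real \<Rightarrow> real" and C assume "continuous_on UNIV f" "\<And>t. \<bar>f t\<bar> \<le> C"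
    then show "(\<lambda>n. \<integral>t. f t \<partial>M (r n)) \<longlonglongrightarrow> (\<integral>t. f t \<partial>N)"
      using weak_conv_imp_integral_bdd_continuous_conv[of "M \<circ> id \<circ> r" N f C] assms(1) r(2,3)
      by (auto simp: continuous_on_eq_continuous_at)
  qed
qed

text \<open>Cosine and sine suffice as test functions, by uniqueness of characteristic functions.\<close>

lemma real_distribution_eqI_continuous:
  assumes "real_distribution M" "real_distribution N"
    and eq: "\<And>f :: real \<Rightarrow> real. continuous_on UNIV f \<Longrightarrow> (\<And>t. \<bar>f t\<bar> \<le> 1) \<Longrightarrow> (\<integral>t. f t \<partial>M) = (\<integral>t. f t \<partial>N)"
  shows "M = N"
proof (rule Levy_uniqueness[OF assms(1,2)], rule ext)
  fix u :: real
  interpret M: real_distribution M by fact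
  interpret N: real_distribution N by fact
  have "(\<integral>t. cos (u * t) \<partial>M) = (\<integral>t. cos (u * t) \<partial>N)" "(\<integral>t. sin (u * t) \<partial>M) = (\<integral>t. sin (u * t) \<partial>N)"
    by (rule eq; auto intro!: continuous_intros)+
  moreover have "Re (char P u) = (\<integral>t. cos (u * t) \<partial>P)" "Im (char P u) = (\<integral>t. sin (u * t) \<partial>P)"
    if "real_distribution P" for P
  proof -
    interpret P: real_distribution P by fact
    have int: "integrable P (\<lambda>t. iexp (u * t))" by (rule P.integrable_iexp) auto
    show "Re (char P u) = (\<integral>t. cos (u * t) \<partial>P)" "Im (char P u) = (\<integral>t. sin (u * t) \<partial>P)"
      using int by (auto simp: char_def simp flip: integral_Re integral_Im simp: Re_exp Im_exp)
  qed
  ultimately show "char M u = char N u"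
    using assms(1,2) by (simp add: complex_eq_iff)
qed

lemma distr_eqI_common_limit:
  fixes a :: "(real \<Rightarrow> real) \<Rightarrow> nat \<Rightarrow> real"
  assumes "prob_space M" "prob_space N"
    and [measurable]: "g \<in> borel_measurable M" "h \<in> borel_measurable N"
    and lim: "\<And>f. continuous_on UNIV f \<Longrightarrow> (\<And>t. \<bar>f t\<bar> \<le> 1) \<Longrightarrow> a f \<longlonglongrightarrow> (\<integral>x. f (g x) \<partial>M)"
             "\<And>f. continuous_on UNIV f \<Longrightarrow> (\<And>t. \<bar>f t\<bar> \<le> 1) \<Longrightarrow> a f \<longlonglongrightarrow> (\<integral>y. f (h y) \<partial>N)"
  shows "distr M borel g = distr N borel h"
proof (rule real_distribution_eqI_continuous)
  show "real_distribution (distr M borel g)" "real_distribution (distr N borel h)"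
    using assms(1,2)
    by (auto intro!: real_distribution.intro prob_space.prob_space_distr
             simp: real_distribution_axioms_def)
  fix f :: "real \<Rightarrow> real" assume f: "continuous_on UNIV f" "\<And>t. \<bar>f t\<bar> \<le> 1"
  have [measurable]: "f \<in> borel_measurable borel"
    using f(1) by (rule borel_measurable_continuous_onI)
  have "(\<integral>x. f (g x) \<partial>M) = (\<integral>y. f (h y) \<partial>N)"
    using LIMSEQ_unique[OF lim[OF f]] .
  then show "(\<integral>t. f t \<partial>distr M borel g) = (\<integral>t. f t \<partial>distr N borel h)"
    by (simp add: integral_distr)
qed

section \<open>Compactness of couplings\<close>

text \<open>The marginals are assumed to converge against every bounded Borel function, which is stronger than
weak convergence.  This permits coding by indicators, which are discontinuous on the underlying
spaces: the law of the code of one coordinate converges although the code is discontinuous.\<close>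

theorem coupling_subsequence_limit:
  fixes \<pi> :: "nat \<Rightarrow> ('a::{banach, second_countable_topology} \<times>
                        'b::{banach, second_countable_topology}) measure"
  assumes sets_\<pi>: "\<And>n. sets (\<pi> n) = sets borel" and prob_\<pi>: "\<And>n. prob_space (\<pi> n)"
    and \<mu>: "sets \<mu> = sets borel" "prob_space \<mu>" and \<nu>: "sets \<nu> = sets borel" "prob_space \<nu>"
    and conv_fst: "\<And>f. f \<in> borel_measurable borel \<Longrightarrow> (\<And>x. \<bar>f x :: real\<bar> \<le> 1) \<Longrightarrow>
           (\<lambda>n. \<integral>z. f (fst z) \<partial>\<pi> n) \<longlonglongrightarrow> (\<integral>x. f x \<partial>\<mu>)"
    and conv_snd: "\<And>f. f \<in> borel_measurable borel \<Longrightarrow> (\<And>y. \<bar>f y :: real\<bar> \<le> 1) \<Longrightarrow>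
           (\<lambda>n. \<integral>z. f (snd z) \<partial>\<pi> n) \<longlonglongrightarrow> (\<integral>y. f y \<partial>\<nu>)"
  obtains r and \<gamma> :: "('a \<times> 'b) measure"
  where "strict_mono r" "sets \<gamma> = sets borel" "prob_space \<gamma>"
    "distr \<gamma> borel fst = \<mu>" "distr \<gamma> borel snd = \<nu>"
    "\<And>c. continuous_on UNIV c \<Longrightarrow> (\<And>z. 0 \<le> c z) \<Longrightarrow>
       (\<integral>\<^sup>+ z. ennreal (c z) \<partial>\<gamma>) \<le> liminf (\<lambda>n. \<integral>\<^sup>+ z. ennreal (c z) \<partial>\<pi> (r n))"
proof -
  note sets_\<pi> [measurable_cong] \<mu>(1) [measurable_cong] \<nu>(1) [measurable_cong]
  obtain U :: "nat \<Rightarrow> 'a set" where U: "topological_basis (range U)"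
    by (rule countable_basis_sequence)
  obtain V :: "nat \<Rightarrow> 'b set" where V: "topological_basis (range V)"
    by (rule countable_basis_sequence)
  have openU: "open (U i)" and openV: "open (V i)" for i
    using U V by (auto dest: topological_basis_open)
  have [measurable]: "U i \<in> sets borel" "V i \<in> sets borel" for i
    using openU[of i] openV[of i] by auto
  define s :: "'a \<times> 'b \<Rightarrow> nat \<Rightarrow> real"
    where "s z k = (if even k then indicator (U (k div 2)) (fst z)
                    else indicator (V (k div 2)) (snd z))" for z k
  define code where "code z = ternary (s z)" for z
  have s01: "s z k \<in> {0, 1}" for z k by (auto simp: s_def indicator_def)
  have digit_code: "digit (2 * i) (code (x, y)) = indicator (U i) x"
                   "digit (Suc (2 * i)) (code (x, y)) = indicator (V i) y" for i x y
    unfolding code_def using digit_ternary[of "s (x, y)", OF s01] by (simp_all add: s_def)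
  have [measurable]: "(\<lambda>z. s z k) \<in> borel_measurable borel" for k
    unfolding s_def borel_prod[symmetric] by measurable
  have [measurable]: "code \<in> borel_measurable borel"
    unfolding code_def[abs_def] ternary_def by measurable
  have code_bounds: "code z \<in> {0..1}" for z
  proof -
    have "s z k \<in> {0..1}" for k using s01[of z k] by auto
    then have "ternary (s z) \<in> {0..1/2}" by (rule ternary_bounds)
    then show ?thesis unfolding code_def by auto
  qed
  have [measurable]: "(fst :: 'a \<times> 'b \<Rightarrow> 'a) \<in> borel_measurable borel"
                     "(snd :: 'a \<times> 'b \<Rightarrow> 'b) \<in> borel_measurable borel"
    by (intro borel_measurable_continuous_onI continuous_intros)+

  have codes: "real_distribution (distr (\<pi> n) borel code)" for n
  proof -
    interpret prob_space "\<pi> n" by (rule prob_\<pi>)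
    show ?thesis by (intro real_distribution.intro prob_space_distr) (auto simp: real_distribution_axioms_def)
  qed
  have "AE t in distr (\<pi> n) borel code. t \<in> {0..1}" for n
    by (subst AE_distr_iff) (use code_bounds in auto)
  with codes obtain r N where r: "strict_mono r" and "real_distribution N"
    and lim': "\<And>f C. continuous_on UNIV f \<Longrightarrow> (\<And>t. \<bar>f t :: real\<bar> \<le> C) \<Longrightarrow>
           (\<lambda>n. \<integral>t. f t \<partial>distr (\<pi> (r n)) borel code) \<longlonglongrightarrow> (\<integral>t. f t \<partial>N)"
    by (rule unit_supported_subsequence_limit[of "\<lambda>n. distr (\<pi> n) borel code"]) blast+
  interpret N: real_distribution N by fact
  have lim: "(\<lambda>n. \<integral>z. f (code z) \<partial>\<pi> (r n)) \<longlonglongrightarrow> (\<integral>t. f t \<partial>N)"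
    if f: "continuous_on UNIV f" "\<And>t. \<bar>f t\<bar> \<le> C" for f :: "real \<Rightarrow> real" and C
  proof -
    have [measurable]: "f \<in> borel_measurable borel"
      using f(1) by (rule borel_measurable_continuous_onI)
    show ?thesis using lim'[OF f] by (simp add: integral_distr)
  qed
  \<comment> \<open>A continuous condition satisfied by all codes passes to the limit law \<open>N\<close>.\<close>
  have null_off_codes: "AE t in N. f t = 0"
    if f: "continuous_on UNIV f" "\<And>t. f t \<in> {0..1}" "\<And>z. f (code z) = 0" for f :: "real \<Rightarrow> real"
  proof -
    have [measurable]: "f \<in> borel_measurable borel"
      using f(1) by (rule borel_measurable_continuous_onI)
    have "(\<lambda>n. \<integral>z. f (code z) \<partial>\<pi> (r n)) \<longlonglongrightarrow> (\<integral>t. f t \<partial>N)"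
      using f(1,2) by (intro lim[of _ 1]) auto
    then have "(\<integral>t. f t \<partial>N) = 0"
      using f(3) by (simp add: LIMSEQ_const_iff)
    moreover have "integrable N f"
      using f(2) by (intro N.integrable_const_bound[where B = 1]) auto
    ultimately show ?thesis
      using f(2) by (subst (asm) integral_nonneg_eq_0_iff_AE) auto
  qed

  define E where "E u t = ternary (\<lambda>i. digit (u i) t)" for u :: "nat \<Rightarrow> nat" and t
  have E_cont: "continuous_on UNIV (E u)" for u
    unfolding E_def using digit_bounds
    by (intro continuous_on_ternary continuous_on_digit continuous_intros) auto
  then have [measurable]: "E u \<in> borel_measurable borel" for u
    by (rule borel_measurable_continuous_onI)
  have E_code: "E (\<lambda>i. 2 * i) (code z) = encode U (fst z)"
               "E (\<lambda>i. Suc (2 * i)) (code z) = encode V (snd z)" for z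
    unfolding E_def encode_def using digit_code[of _ "fst z" "snd z"] by simp_all
  have E_digits: "AE t in N. \<forall>i. digit i (E u t) = digit (u i) t"
    if "\<And>z i. digit i (E u (code z)) = digit (u i) (code z)" for u
  proof (subst AE_all_countable, rule allI)
    fix i
    have "AE t in N. \<bar>digit i (E u t) - digit (u i) t\<bar> = 0"
    proof (rule null_off_codes)
      show "continuous_on UNIV (\<lambda>t. \<bar>digit i (E u t) - digit (u i) t\<bar>)"
        by (intro continuous_intros continuous_on_digit E_cont)
      show "\<bar>digit i (E u t) - digit (u i) t\<bar> \<in> {0..1}" for t
        using digit_bounds[of i "E u t"] digit_bounds[of "u i" t] by auto
    qed (simp add: that)
    then show "AE t in N. digit i (E u t) = digit (u i) t" by eventually_elim simp
  qed

  \<comment> \<open>\<open>E u\<close> is the code of one coordinate.  Its law under \<open>N\<close> is, by continuity, the limit of the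
    laws of the codes of that coordinate under \<open>\<pi> (r n)\<close>; the assumed convergence of the
    marginals identifies the same limit as the law of the code under \<open>\<mu>\<close> (or \<open>\<nu>\<close>).\<close>
  have law_fst: "distr N borel (E (\<lambda>i. 2 * i)) = distr \<mu> borel (encode U)"
  proof (rule distr_eqI_common_limit[OF N.prob_space_axioms \<mu>(2)])
    have [measurable]: "encode U \<in> borel_measurable borel" by (rule measurable_encode) auto
    then show "encode U \<in> borel_measurable \<mu>" by measurable
    show "E (\<lambda>i. 2 * i) \<in> borel_measurable N" by measurable
    fix f :: "real \<Rightarrow> real" assume f: "continuous_on UNIV f" "\<And>t. \<bar>f t\<bar> \<le> 1"
    have [measurable]: "f \<in> borel_measurable borel"
      using f(1) by (rule borel_measurable_continuous_onI)
    have "(\<lambda>n. \<integral>z. f (E (\<lambda>i. 2 * i) (code z)) \<partial>\<pi> (r n)) \<longlonglongrightarrow> (\<integral>t. f (E (\<lambda>i. 2 * i) t) \<partial>N)"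
      using f by (intro lim[of _ 1] continuous_on_compose2[OF f(1) E_cont]) auto
    then show "(\<lambda>n. \<integral>z. f (encode U (fst z)) \<partial>\<pi> (r n)) \<longlonglongrightarrow> (\<integral>t. f (E (\<lambda>i. 2 * i) t) \<partial>N)"
      by (simp only: E_code)
    show "(\<lambda>n. \<integral>z. f (encode U (fst z)) \<partial>\<pi> (r n)) \<longlonglongrightarrow> (\<integral>x. f (encode U x) \<partial>\<mu>)"
      using LIMSEQ_subseq_LIMSEQ[OF conv_fst[of "\<lambda>x. f (encode U x)"] r] f(2) by (simp add: comp_def)
  qed
  have law_snd: "distr N borel (E (\<lambda>i. Suc (2 * i))) = distr \<nu> borel (encode V)"
  proof (rule distr_eqI_common_limit[OF N.prob_space_axioms \<nu>(2)])
    have [measurable]: "encode V \<in> borel_measurable borel" by (rule measurable_encode) auto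
    then show "encode V \<in> borel_measurable \<nu>" by measurable
    show "E (\<lambda>i. Suc (2 * i)) \<in> borel_measurable N" by measurable
    fix f :: "real \<Rightarrow> real" assume f: "continuous_on UNIV f" "\<And>t. \<bar>f t\<bar> \<le> 1"
    have [measurable]: "f \<in> borel_measurable borel"
      using f(1) by (rule borel_measurable_continuous_onI)
    have "(\<lambda>n. \<integral>z. f (E (\<lambda>i. Suc (2 * i)) (code z)) \<partial>\<pi> (r n)) \<longlonglongrightarrow> (\<integral>t. f (E (\<lambda>i. Suc (2 * i)) t) \<partial>N)"
      using f by (intro lim[of _ 1] continuous_on_compose2[OF f(1) E_cont]) auto
    then show "(\<lambda>n. \<integral>z. f (encode V (snd z)) \<partial>\<pi> (r n)) \<longlonglongrightarrow> (\<integral>t. f (E (\<lambda>i. Suc (2 * i)) t) \<partial>N)"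
      by (simp only: E_code)
    show "(\<lambda>n. \<integral>z. f (encode V (snd z)) \<partial>\<pi> (r n)) \<longlonglongrightarrow> (\<integral>x. f (encode V x) \<partial>\<nu>)"
      using LIMSEQ_subseq_LIMSEQ[OF conv_snd[of "\<lambda>x. f (encode V x)"] r] f(2) by (simp add: comp_def)
  qed

  have dE: "digit i (E (\<lambda>i. 2 * i) (code z)) = digit (2 * i) (code z)"
           "digit i (E (\<lambda>i. Suc (2 * i)) (code z)) = digit (Suc (2 * i)) (code z)" for i z
    unfolding E_code digit_encode using digit_code[of i "fst z" "snd z"] by simp_all
  obtain X where X [measurable]: "X \<in> borel_measurable borel" and "distr N borel X = \<mu>"
    and digX: "AE t in N. \<forall>i. digit (2 * i) t = indicator (U i) (X t)"
    by (rule decode_marginal[OF N.real_distribution_axioms U \<mu>(1) _ law_fst E_digits[OF dE(1)]]) auto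
  obtain Y where Y [measurable]: "Y \<in> borel_measurable borel" and "distr N borel Y = \<nu>"
    and digY: "AE t in N. \<forall>i. digit (Suc (2 * i)) t = indicator (V i) (Y t)"
    by (rule decode_marginal[OF N.real_distribution_axioms V \<nu>(1) _ law_snd E_digits[OF dE(2)]]) auto
  have [measurable]: "(\<lambda>t. (X t, Y t)) \<in> borel_measurable borel"
    by (rule borel_measurable_Pair) (rule X Y)+
  define \<gamma> where "\<gamma> = distr N borel (\<lambda>t. (X t, Y t))"
  show thesis
  proof (rule that[OF r])
    show "sets \<gamma> = sets borel" by (simp add: \<gamma>_def)
    show "prob_space \<gamma>" unfolding \<gamma>_def by (rule N.prob_space_distr) auto
    show "distr \<gamma> borel fst = \<mu>"
      unfolding \<gamma>_def by (subst distr_distr) (auto simp: comp_def \<open>distr N borel X = \<mu>\<close>)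
    show "distr \<gamma> borel snd = \<nu>"
      unfolding \<gamma>_def by (subst distr_distr) (auto simp: comp_def \<open>distr N borel Y = \<nu>\<close>)
    fix c :: "'a \<times> 'b \<Rightarrow> real" assume c: "continuous_on UNIV c" "\<And>z. 0 \<le> c z"
    have [measurable]: "c \<in> borel_measurable borel"
      using c(1) by (rule borel_measurable_continuous_onI)
    obtain w :: "nat \<Rightarrow> real" and i j where w0: "\<And>k. 0 \<le> w k"
      and below: "\<And>k x y. w k * indicator (U (i k)) x * indicator (V (j k)) y \<le> c (x, y)"
      and dense: "\<And>x y a. a < c (x, y) \<Longrightarrow> \<exists>k. a < w k * indicator (U (i k)) x * indicator (V (j k)) y"
      by (rule continuous_sup_of_boxes[OF U V c]) blast
    define cm where "cm m z = running_max (\<lambda>k. w k * indicator (U (i k)) (fst z) * indicator (V (j k)) (snd z)) m"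
      for m and z :: "'a \<times> 'b"
    define G where "G m t = running_max (\<lambda>k. w k * digit (2 * i k) t * digit (Suc (2 * j k)) t) m" for m t
    have G_code: "G m (code z) = cm m z" for m z
      unfolding G_def cm_def by (cases z) (simp only: digit_code fst_conv snd_conv)
    have G_cont: "continuous_on UNIV (G m)" for m
      unfolding G_def by (intro continuous_on_running_max continuous_intros continuous_on_digit)
    then have [measurable]: "G m \<in> borel_measurable borel" for m
      by (rule borel_measurable_continuous_onI)
    have [measurable]: "cm m \<in> borel_measurable borel" for m
    proof -
      have "(\<lambda>z. G m (code z)) \<in> borel_measurable borel" by measurable
      then show ?thesis by (simp add: G_code)
    qed
    have term_nonneg: "0 \<le> w k * digit a t * digit b t" for k a b t
      using w0[of k] digit_bounds[of a t] digit_bounds[of b t] by auto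
    have G_nonneg: "0 \<le> G m t" for m t
      unfolding G_def using running_max_upper[of 0 m] term_nonneg by (meson order_trans zero_le)
    have G_upper: "G m t \<le> running_max w m" for m t
      unfolding G_def
    proof (rule running_max_mono)
      fix k
      have "digit (2 * i k) t * digit (Suc (2 * j k)) t \<le> 1"
        using digit_bounds[of "2 * i k" t] digit_bounds[of "Suc (2 * j k)" t] by (simp add: mult_le_one)
      then show "w k * digit (2 * i k) t * digit (Suc (2 * j k)) t \<le> w k"
        using mult_left_le[OF _ w0] by (simp add: mult.assoc)
    qed
    have cm_le: "cm m z \<le> c z" for m z
      unfolding cm_def using below[of _ "fst z" "snd z"] by (intro running_max_least) simp
    \<comment> \<open>\<open>cm m\<close> is a continuous function of the code, so its integrals converge along \<open>r\<close>.\<close>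
    have level: "(\<integral>\<^sup>+ z. ennreal (cm m z) \<partial>\<gamma>) \<le> liminf (\<lambda>n. \<integral>\<^sup>+ z. ennreal (c z) \<partial>\<pi> (r n))" for m
    proof -
      have int: "integrable P (\<lambda>z. G m (g z))" if "prob_space P" "g \<in> borel_measurable P" for P :: "'z measure" and g
      proof -
        interpret prob_space P by fact
        note that(2) [measurable]
        show ?thesis
          by (intro integrable_const_bound[where B = "running_max w m"])
             (auto simp: G_nonneg G_upper abs_of_nonneg)
      qed
      have ae: "AE t in N. cm m (X t, Y t) = G m t"
        using digX digY by eventually_elim (simp add: cm_def G_def)
      have "(\<integral>\<^sup>+ z. ennreal (cm m z) \<partial>\<gamma>) = (\<integral>\<^sup>+ t. ennreal (cm m (X t, Y t)) \<partial>N)"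
        unfolding \<gamma>_def by (subst nn_integral_distr) auto
      also have "\<dots> = (\<integral>\<^sup>+ t. ennreal (G m t) \<partial>N)"
        using ae by (auto intro!: nn_integral_cong_AE elim!: eventually_mono)
      also have "\<dots> = ennreal (\<integral>t. G m t \<partial>N)"
        using int[OF N.prob_space_axioms, of "\<lambda>t. t"] by (intro nn_integral_eq_integral) (auto simp: G_nonneg)
      finally have lhs: "(\<integral>\<^sup>+ z. ennreal (cm m z) \<partial>\<gamma>) = ennreal (\<integral>t. G m t \<partial>N)" .
      have "(\<integral>\<^sup>+ z. ennreal (cm m z) \<partial>\<pi> n) = ennreal (\<integral>z. G m (code z) \<partial>\<pi> n)" for n
        unfolding G_code[symmetric]
        using int[OF prob_\<pi>, of code n] by (intro nn_integral_eq_integral) (auto simp: G_nonneg)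
      moreover have "(\<lambda>n. ennreal (\<integral>z. G m (code z) \<partial>\<pi> (r n))) \<longlonglongrightarrow> ennreal (\<integral>t. G m t \<partial>N)"
        by (intro tendsto_ennrealI lim[of _ "running_max w m"] G_cont)
           (simp add: G_nonneg G_upper abs_of_nonneg)
      ultimately have "(\<lambda>n. \<integral>\<^sup>+ z. ennreal (cm m z) \<partial>\<pi> (r n)) \<longlonglongrightarrow> (\<integral>\<^sup>+ z. ennreal (cm m z) \<partial>\<gamma>)"
        unfolding lhs by simp
      then have "(\<integral>\<^sup>+ z. ennreal (cm m z) \<partial>\<gamma>) = liminf (\<lambda>n. \<integral>\<^sup>+ z. ennreal (cm m z) \<partial>\<pi> (r n))"
        by (intro lim_imp_Liminf[symmetric]) auto
      also have "\<dots> \<le> liminf (\<lambda>n. \<integral>\<^sup>+ z. ennreal (c z) \<partial>\<pi> (r n))"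
        by (intro Liminf_mono always_eventually allI nn_integral_mono ennreal_leI cm_le)
      finally show ?thesis .
    qed
    have sup: "ennreal (c z) \<le> (SUP m. ennreal (cm m z))" for z
    proof (rule dense_le)
      fix a assume a: "a < ennreal (c z)"
      then obtain b where b: "a = ennreal b" "0 \<le> b"
        by (cases a) auto
      with a have "b < c (fst z, snd z)" by (simp add: ennreal_less_iff)
      then obtain k where "b < w k * indicator (U (i k)) (fst z) * indicator (V (j k)) (snd z)"
        using dense by blast
      also have "\<dots> \<le> cm k z" unfolding cm_def by (rule running_max_upper) simp
      finally have "a \<le> ennreal (cm k z)" using b by (simp add: ennreal_leI)
      then show "a \<le> (SUP m. ennreal (cm m z))" by (rule SUP_upper2[rotated]) simp
    qed
    have "(\<integral>\<^sup>+ z. ennreal (c z) \<partial>\<gamma>) \<le> (\<integral>\<^sup>+ z. (SUP m. ennreal (cm m z)) \<partial>\<gamma>)"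
      by (intro nn_integral_mono sup)
    also have "\<dots> = (SUP m. \<integral>\<^sup>+ z. ennreal (cm m z) \<partial>\<gamma>)"
    proof (rule nn_integral_monotone_convergence_SUP)
      show "incseq (\<lambda>m z. ennreal (cm m z))"
        using incseq_running_max by (auto simp: incseq_def le_fun_def cm_def intro!: ennreal_leI)
      show "(\<lambda>z. ennreal (cm m z)) \<in> borel_measurable \<gamma>" for m
        unfolding \<gamma>_def by measurable
    qed
    also have "\<dots> \<le> liminf (\<lambda>n. \<integral>\<^sup>+ z. ennreal (c z) \<partial>\<pi> (r n))"
      by (rule SUP_least) (rule level)
    finally show "(\<integral>\<^sup>+ z. ennreal (c z) \<partial>\<gamma>) \<le> liminf (\<lambda>n. \<integral>\<^sup>+ z. ennreal (c z) \<partial>\<pi> (r n))" .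
  qed
qed

section \<open>Optimal transport between densities\<close>

text \<open>Nonnegativity is only almost everywhere, which is all that a weak limit in \<open>L\<^sup>1\<close> of nonnegative
functions inherits.\<close>

definition prob_density :: "(real^'d \<Rightarrow> real) \<Rightarrow> bool" where
  "prob_density \<rho> \<longleftrightarrow> integrable lebesgue \<rho> \<and> (AE x in lebesgue. 0 \<le> \<rho> x) \<and>
     (\<integral>x. \<rho> x \<partial>lebesgue) = 1"

lemma measurable_lebesgue_borel [measurable]: "(\<lambda>x. x) \<in> lebesgue \<rightarrow>\<^sub>M borel"
  by (simp add: measurable_completion)

lemma sets_density_borel [simp, measurable_cong]: "sets (density_borel \<rho>) = sets borel"
  by (simp add: density_borel_def)

lemma nn_integral_density_borel:
  assumes "\<rho> \<in> borel_measurable lebesgue" and f: "f \<in> borel_measurable borel"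
  shows "(\<integral>\<^sup>+ x. f x \<partial>density_borel \<rho>) = (\<integral>\<^sup>+ x. ennreal (\<rho> x) * f x \<partial>lebesgue)"
proof -
  note assms [measurable]
  have [measurable]: "f \<in> borel_measurable lebesgue"
    using f by (simp add: measurable_completion)
  show ?thesis unfolding density_borel_def
    by (subst nn_integral_distr) (auto simp: nn_integral_density)
qed

lemma integral_density_borel:
  assumes "prob_density \<rho>" and f: "f \<in> borel_measurable borel"
  shows "(\<integral>x. f x \<partial>density_borel \<rho>) = (\<integral>x. \<rho> x * f x \<partial>lebesgue)"
proof -
  have [measurable]: "\<rho> \<in> borel_measurable lebesgue" and nn: "AE x in lebesgue. 0 \<le> \<rho> x"
    using assms(1) by (auto simp: prob_density_def)
  note f [measurable]
  have [measurable]: "f \<in> borel_measurable lebesgue"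
    using f by (simp add: measurable_completion)
  show ?thesis unfolding density_borel_def
    using nn by (subst integral_distr) (auto simp: integral_density)
qed

lemma prob_space_density_borel:
  assumes "prob_density \<rho>"
  shows "prob_space (density_borel \<rho>)"
proof
  have [measurable]: "\<rho> \<in> borel_measurable lebesgue" using assms by (auto simp: prob_density_def)
  have "emeasure (density_borel \<rho>) (space (density_borel \<rho>)) = (\<integral>\<^sup>+ x. 1 \<partial>density_borel \<rho>)"
    by simp
  also have "\<dots> = (\<integral>\<^sup>+ x. ennreal (\<rho> x) \<partial>lebesgue)"
    by (subst nn_integral_density_borel) auto
  also have "\<dots> = 1"
    using assms by (subst nn_integral_eq_integral) (auto simp: prob_density_def)
  finally show "emeasure (density_borel \<rho>) (space (density_borel \<rho>)) = 1" .
qed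

lemma couplings_nonempty:
  fixes \<rho> \<rho>' :: "real^'d \<Rightarrow> real"
  assumes "prob_density \<rho>" "prob_density \<rho>'"
  shows "couplings \<rho> \<rho>' \<noteq> {}"
proof -
  let ?M = "density_borel \<rho>" and ?N = "density_borel \<rho>'"
  interpret M: prob_space ?M by (rule prob_space_density_borel) fact
  interpret N: prob_space ?N by (rule prob_space_density_borel) fact
  interpret pair_prob_space ?M ?N ..
  have [simp]: "space (density_borel \<sigma>) = UNIV" for \<sigma> :: "real^'d \<Rightarrow> real"
    by (simp add: density_borel_def)
  have sets: "sets (?M \<Otimes>\<^sub>M ?N) = sets borel"
    by (simp add: borel_prod[symmetric] cong: sets_pair_measure_cong)
  have "distr (?M \<Otimes>\<^sub>M ?N) borel fst = ?M"
  proof (rule measure_eqI)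
    fix A assume "A \<in> sets (distr (?M \<Otimes>\<^sub>M ?N) borel fst)"
    then have "emeasure (distr (?M \<Otimes>\<^sub>M ?N) borel fst) A = emeasure (?M \<Otimes>\<^sub>M ?N) (A \<times> space ?N)"
      by (subst emeasure_distr) (auto simp: space_pair_measure intro!: arg_cong2[where f = emeasure])
    also have "\<dots> = emeasure ?M A"
      using \<open>A \<in> _\<close> by (subst N.emeasure_pair_measure_Times) (use N.emeasure_space_1 in auto)
    finally show "emeasure (distr (?M \<Otimes>\<^sub>M ?N) borel fst) A = emeasure ?M A" .
  qed simp
  moreover have "distr (?M \<Otimes>\<^sub>M ?N) borel snd = ?N"
  proof (rule measure_eqI)
    fix A assume "A \<in> sets (distr (?M \<Otimes>\<^sub>M ?N) borel snd)"
    then have "emeasure (distr (?M \<Otimes>\<^sub>M ?N) borel snd) A = emeasure (?M \<Otimes>\<^sub>M ?N) (space ?M \<times> A)"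
      by (subst emeasure_distr) (auto simp: space_pair_measure intro!: arg_cong2[where f = emeasure])
    also have "\<dots> = emeasure ?N A"
      using \<open>A \<in> _\<close> by (subst N.emeasure_pair_measure_Times) (use M.emeasure_space_1 in auto)
    finally show "emeasure (distr (?M \<Otimes>\<^sub>M ?N) borel snd) A = emeasure ?N A" .
  qed simp
  ultimately have "?M \<Otimes>\<^sub>M ?N \<in> couplings \<rho> \<rho>'"
    unfolding couplings_def using sets prob_space_axioms by simp
  then show ?thesis by blast
qed

lemma measurable_couplings:
  assumes "\<pi> \<in> couplings \<rho> \<rho>'"
  shows "fst \<in> \<pi> \<rightarrow>\<^sub>M borel" "snd \<in> \<pi> \<rightarrow>\<^sub>M borel"
proof -
  have "fst \<in> borel_measurable (borel :: ((real^'d) \<times> (real^'d)) measure)"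
       "snd \<in> borel_measurable (borel :: ((real^'d) \<times> (real^'d)) measure)"
    by (intro borel_measurable_continuous_onI continuous_intros)+
  then show "fst \<in> \<pi> \<rightarrow>\<^sub>M borel" "snd \<in> \<pi> \<rightarrow>\<^sub>M borel"
    using assms by (auto simp: couplings_def cong: measurable_cong_sets)
qed

text \<open>Weak convergence in \<open>L\<^sup>1\<close> is convergence against all bounded measurable functions, so the couplings
subconverge.  Passing first to a subsequence along which the cost tends to its lower limit makes
that further subsequence harmless.\<close>

lemma transport_cost_limit:
  fixes \<rho>0 \<rho> :: "real^'d \<Rightarrow> real" and b :: "real^'d \<Rightarrow> real^'q"
  assumes \<rho>0: "prob_density \<rho>0" and \<rho>s: "\<And>n. prob_density (\<rho>s n)" and \<rho>: "prob_density \<rho>"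
    and weak: "weakly_converges_L1 \<rho>s \<rho>" and b: "continuous_on UNIV b"
    and \<pi>: "\<And>n. \<pi> n \<in> couplings \<rho>0 (\<rho>s n)"
  obtains \<gamma> where "\<gamma> \<in> couplings \<rho>0 \<rho>"
    "transport_cost b \<gamma> \<le> liminf (\<lambda>n. transport_cost b (\<pi> n))"
proof -
  obtain k :: "nat \<Rightarrow> nat" where k: "strict_mono k"
      "((\<lambda>n. transport_cost b (\<pi> n)) \<circ> k) \<longlonglongrightarrow> liminf (\<lambda>n. transport_cost b (\<pi> n))"
    using liminf_subseq_lim by blast
  have sets_\<pi>: "sets (\<pi> n) = sets borel" and prob_\<pi>: "prob_space (\<pi> n)"
    and marg: "distr (\<pi> n) borel fst = density_borel \<rho>0" "distr (\<pi> n) borel snd = density_borel (\<rho>s n)" for n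
    using \<pi>[of n] by (auto simp: couplings_def)
  have proj: "fst \<in> \<pi> n \<rightarrow>\<^sub>M borel" "snd \<in> \<pi> n \<rightarrow>\<^sub>M borel" for n
    using measurable_couplings[OF \<pi>] by auto
  note measurable_couplings [OF \<pi>, measurable]
  have conv_fst: "(\<lambda>n. \<integral>z. f (fst z) \<partial>\<pi> (k n)) \<longlonglongrightarrow> (\<integral>x. f x \<partial>density_borel \<rho>0)"
    if "f \<in> borel_measurable borel" for f :: "real^'d \<Rightarrow> real"
  proof -
    have "(\<integral>z. f (fst z) \<partial>\<pi> n) = (\<integral>x. f x \<partial>density_borel \<rho>0)" for n
      unfolding marg(1)[of n, symmetric] by (rule integral_distr[symmetric]) (rule proj that)+
    then show ?thesis by simp
  qed
  have conv_snd: "(\<lambda>n. \<integral>z. f (snd z) \<partial>\<pi> (k n)) \<longlonglongrightarrow> (\<integral>x. f x \<partial>density_borel \<rho>)"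
    if f: "f \<in> borel_measurable borel" and f1: "\<And>x. \<bar>f x\<bar> \<le> 1" for f :: "real^'d \<Rightarrow> real"
  proof -
    have "ess_bounded f"
      unfolding ess_bounded_def using f f1 by (auto simp: measurable_completion)
    then have "(\<lambda>n. \<integral>x. \<rho>s n x * f x \<partial>lebesgue) \<longlonglongrightarrow> (\<integral>x. \<rho> x * f x \<partial>lebesgue)"
      using weak by (auto simp: weakly_converges_L1_def)
    then have "(\<lambda>n. \<integral>x. f x \<partial>density_borel (\<rho>s n)) \<longlonglongrightarrow> (\<integral>x. f x \<partial>density_borel \<rho>)"
      using \<rho>s \<rho> f by (simp add: integral_density_borel)
    moreover have "(\<integral>z. f (snd z) \<partial>\<pi> n) = (\<integral>x. f x \<partial>density_borel (\<rho>s n))" for n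
      unfolding marg(2)[of n, symmetric] by (rule integral_distr[symmetric]) (rule proj f)+
    ultimately have "(\<lambda>n. \<integral>z. f (snd z) \<partial>\<pi> n) \<longlonglongrightarrow> (\<integral>x. f x \<partial>density_borel \<rho>)"
      by simp
    from LIMSEQ_subseq_LIMSEQ[OF this k(1)] show ?thesis by (simp only: comp_def)
  qed
  obtain r \<gamma> where r: "strict_mono r" and \<gamma>: "sets \<gamma> = sets borel" "prob_space \<gamma>"
      "distr \<gamma> borel fst = density_borel \<rho>0" "distr \<gamma> borel snd = density_borel \<rho>"
    and lsc: "\<And>c. continuous_on UNIV c \<Longrightarrow> (\<And>z. 0 \<le> c z) \<Longrightarrow>
       (\<integral>\<^sup>+ z. ennreal (c z) \<partial>\<gamma>) \<le> liminf (\<lambda>n. \<integral>\<^sup>+ z. ennreal (c z) \<partial>\<pi> (k (r n)))"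
    by (rule coupling_subsequence_limit[of "\<lambda>n. \<pi> (k n)" "density_borel \<rho>0" "density_borel \<rho>",
          OF sets_\<pi> prob_\<pi> sets_density_borel prob_space_density_borel[OF \<rho>0]
             sets_density_borel prob_space_density_borel[OF \<rho>] conv_fst conv_snd]) blast+
  have "transport_cost b \<gamma> \<le> liminf (\<lambda>n. transport_cost b (\<pi> (k (r n))))"
    unfolding transport_cost_def case_prod_beta
    by (rule lsc) (auto intro!: continuous_intros continuous_on_compose2[OF b])
  also have "\<dots> = liminf (\<lambda>n. transport_cost b (\<pi> n))"
    using LIMSEQ_subseq_LIMSEQ[OF k(2) r] by (intro lim_imp_Liminf) (auto simp: comp_def)
  finally show thesis using \<gamma> by (intro that[of \<gamma>]) (auto simp: couplings_def)
qed

text \<open>A minimizing sequence of couplings of two fixed densities is the case of constant densities in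
\<open>transport_cost_limit\<close>.\<close>

lemma optimal_coupling_exists:
  assumes \<rho>: "prob_density \<rho>" and \<rho>': "prob_density \<rho>'" and b: "continuous_on UNIV b"
  obtains \<pi> where "\<pi> \<in> couplings \<rho> \<rho>'"
    "\<And>\<pi>'. \<pi>' \<in> couplings \<rho> \<rho>' \<Longrightarrow> transport_cost b \<pi> \<le> transport_cost b \<pi>'"
proof -
  let ?C = "transport_cost b ` couplings \<rho> \<rho>'"
  have "?C \<noteq> {}" using couplings_nonempty[OF \<rho> \<rho>'] by simp
  from ennreal_Inf_countable_INF[OF this] obtain f :: "nat \<Rightarrow> ennreal"
    where f: "decseq f" "range f \<subseteq> ?C" "Inf ?C = (INF n. f n)"
    by (elim exE conjE)
  have "\<exists>\<pi>. \<pi> \<in> couplings \<rho> \<rho>' \<and> transport_cost b \<pi> = f n" for n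
  proof -
    have "f n \<in> ?C" using f(2) by blast
    then show ?thesis by auto
  qed
  then obtain \<pi> where \<pi>: "\<And>n. \<pi> n \<in> couplings \<rho> \<rho>'" "\<And>n. transport_cost b (\<pi> n) = f n"
    by metis
  have "weakly_converges_L1 (\<lambda>n. \<rho>') \<rho>'"
    using \<rho>' by (simp add: weakly_converges_L1_def prob_density_def)
  then obtain \<gamma> where \<gamma>: "\<gamma> \<in> couplings \<rho> \<rho>'"
      "transport_cost b \<gamma> \<le> liminf (\<lambda>n. transport_cost b (\<pi> n))"
    by (rule transport_cost_limit[OF \<rho> \<rho>' \<rho>' _ b \<pi>(1)])
  have "liminf (\<lambda>n. transport_cost b (\<pi> n)) = Inf ?C"
    unfolding \<pi>(2) f(3) using LIMSEQ_INF[OF f(1)] by (intro lim_imp_Liminf) auto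
  with \<gamma>(2) have "transport_cost b \<gamma> \<le> Inf ?C" by simp
  then have "transport_cost b \<gamma> \<le> transport_cost b \<pi>'" if "\<pi>' \<in> couplings \<rho> \<rho>'" for \<pi>'
    using that by (meson INF_lower order_trans)
  with \<gamma>(1) show thesis by (rule that)
qed

lemma W_A_squared:
  assumes "\<pi> \<in> couplings \<rho> \<rho>'"
    and "\<And>\<pi>'. \<pi>' \<in> couplings \<rho> \<rho>' \<Longrightarrow> transport_cost b \<pi> \<le> transport_cost b \<pi>'"
  shows "(W_A b \<rho> \<rho>')\<^sup>2 = enn2real (transport_cost b \<pi>)"
proof -
  have "(LEAST c. c \<in> transport_cost b ` couplings \<rho> \<rho>') = transport_cost b \<pi>"
    using assms by (intro Least_equality) auto
  then show ?thesis by (simp add: W_A_def)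
qed

lemma transport_cost_le_moments:
  fixes \<rho> \<rho>' :: "real^'d \<Rightarrow> real" and b :: "real^'d \<Rightarrow> real^'q"
  assumes [measurable]: "b \<in> borel_measurable borel" and \<pi>: "\<pi> \<in> couplings \<rho> \<rho>'"
  shows "transport_cost b \<pi> \<le> 2 * (\<integral>\<^sup>+ x. ennreal ((norm (b x))\<^sup>2) \<partial>density_borel \<rho>)
                          + 2 * (\<integral>\<^sup>+ y. ennreal ((norm (b y))\<^sup>2) \<partial>density_borel \<rho>')"
proof -
  have marg: "density_borel \<rho> = distr \<pi> borel fst" "density_borel \<rho>' = distr \<pi> borel snd"
    using \<pi> by (auto simp: couplings_def)
  note measurable_couplings [OF \<pi>, measurable]
  have ineq: "(norm (b x - b y))\<^sup>2 \<le> 2 * (norm (b x))\<^sup>2 + 2 * (norm (b y))\<^sup>2" for x y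
  proof -
    have "(norm (b x - b y))\<^sup>2 \<le> (norm (b x) + norm (b y))\<^sup>2"
      by (intro power_mono norm_triangle_ineq4) auto
    also have "\<dots> \<le> 2 * (norm (b x))\<^sup>2 + 2 * (norm (b y))\<^sup>2"
      using sum_squares_bound[of "norm (b x)" "norm (b y)"] by (simp add: power2_sum)
    finally show ?thesis .
  qed
  have "transport_cost b \<pi> \<le> (\<integral>\<^sup>+ z. 2 * ennreal ((norm (b (fst z)))\<^sup>2) + 2 * ennreal ((norm (b (snd z)))\<^sup>2) \<partial>\<pi>)"
    unfolding transport_cost_def case_prod_beta
  proof (rule nn_integral_mono)
    fix z :: "(real^'d) \<times> (real^'d)"
    have "ennreal ((norm (b (fst z) - b (snd z)))\<^sup>2) \<le> ennreal (2 * (norm (b (fst z)))\<^sup>2 + 2 * (norm (b (snd z)))\<^sup>2)"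
      by (intro ennreal_leI ineq)
    then show "ennreal ((norm (b (fst z) - b (snd z)))\<^sup>2) \<le> 2 * ennreal ((norm (b (fst z)))\<^sup>2) + 2 * ennreal ((norm (b (snd z)))\<^sup>2)"
      by (simp add: ennreal_mult)
  qed
  also have "\<dots> = 2 * (\<integral>\<^sup>+ z. ennreal ((norm (b (fst z)))\<^sup>2) \<partial>\<pi>) + 2 * (\<integral>\<^sup>+ z. ennreal ((norm (b (snd z)))\<^sup>2) \<partial>\<pi>)"
    by (simp add: nn_integral_add nn_integral_cmult)
  also have "\<dots> = 2 * (\<integral>\<^sup>+ x. ennreal ((norm (b x))\<^sup>2) \<partial>density_borel \<rho>)
                + 2 * (\<integral>\<^sup>+ y. ennreal ((norm (b y))\<^sup>2) \<partial>density_borel \<rho>')"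
    unfolding marg by (simp add: nn_integral_distr)
  finally show ?thesis .
qed

text \<open>Finite optimal cost is what makes the conversion \<open>enn2real\<close> in \<open>W_A\<close> faithful.\<close>

lemma transport_cost_finite:
  assumes b: "b \<in> borel_measurable borel" and \<pi>: "\<pi> \<in> couplings \<rho> \<rho>'"
    and "\<rho> \<in> K b" "\<rho>' \<in> K b"
  shows "transport_cost b \<pi> < \<top>"
proof -
  have "(\<integral>\<^sup>+ x. ennreal ((norm (b x))\<^sup>2) \<partial>density_borel \<sigma>) < \<top>" if "\<sigma> \<in> K b" for \<sigma>
  proof -
    note b [measurable]
    have \<sigma>: "\<sigma> \<in> borel_measurable lebesgue" "\<And>x. 0 \<le> \<sigma> x"
      "integrable lebesgue (\<lambda>x. (norm (b x))\<^sup>2 * \<sigma> x)"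
      using that by (auto simp: K_def finite_M_b_def)
    have "(\<integral>\<^sup>+ x. ennreal ((norm (b x))\<^sup>2) \<partial>density_borel \<sigma>)
        = (\<integral>\<^sup>+ x. ennreal ((norm (b x))\<^sup>2 * \<sigma> x) \<partial>lebesgue)"
      using \<sigma>(1,2) by (subst nn_integral_density_borel) (auto simp: ennreal_mult mult.commute)
    also have "\<dots> < \<top>"
      using \<sigma>(3,2) by (subst nn_integral_eq_integral) auto
    finally show ?thesis .
  qed
  then have "2 * (\<integral>\<^sup>+ x. ennreal ((norm (b x))\<^sup>2) \<partial>density_borel \<rho>)
           + 2 * (\<integral>\<^sup>+ y. ennreal ((norm (b y))\<^sup>2) \<partial>density_borel \<rho>') < \<top>"
    using assms(3,4) by (simp add: ennreal_mult_less_top)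
  with transport_cost_le_moments[OF b \<pi>] show ?thesis by (rule le_less_trans)
qed

section \<open>Weak limits of densities\<close>

lemma K_imp_prob_density: "\<rho> \<in> K b \<Longrightarrow> prob_density \<rho>"
  by (simp add: K_def prob_density_def)

text \<open>The test functions are the indicator of \<open>{x. \<rho> x < 0}\<close>, for the sign, and the constant 1, for the
total mass.\<close>

lemma prob_density_weak_limit:
  assumes dens: "\<And>n. prob_density (\<rho>s n)" and weak: "weakly_converges_L1 \<rho>s \<rho>"
  shows "prob_density \<rho>"
proof -
  have int: "integrable lebesgue \<rho>" and ints: "integrable lebesgue (\<rho>s n)" for n
    using weak by (auto simp: weakly_converges_L1_def)
  have lim: "(\<lambda>n. \<integral>x. \<rho>s n x * \<phi> x \<partial>lebesgue) \<longlonglongrightarrow> (\<integral>x. \<rho> x * \<phi> x \<partial>lebesgue)" if "ess_bounded \<phi>" for \<phi>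
    using weak that by (auto simp: weakly_converges_L1_def)
  have [measurable]: "\<rho> \<in> borel_measurable lebesgue" using int by auto
  define \<phi> where "\<phi> x = (indicator {x. \<rho> x < 0} x :: real)" for x
  have [measurable]: "\<phi> \<in> borel_measurable lebesgue"
    unfolding \<phi>_def indicator_def by measurable
  have "ess_bounded \<phi>"
    unfolding ess_bounded_def by (auto intro!: exI[of _ 1] simp: \<phi>_def indicator_def)
  from lim[OF this] have "0 \<le> (\<integral>x. \<rho> x * \<phi> x \<partial>lebesgue)"
  proof (rule LIMSEQ_le_const, intro exI allI impI)
    fix n show "0 \<le> (\<integral>x. \<rho>s n x * \<phi> x \<partial>lebesgue)"
      using dens[of n] by (intro integral_nonneg_AE) (auto simp: prob_density_def \<phi>_def elim!: eventually_mono)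
  qed
  moreover have "integrable lebesgue (\<lambda>x. - (\<rho> x * \<phi> x))"
    by (rule Bochner_Integration.integrable_bound[OF int]) (auto simp: \<phi>_def indicator_def)
  moreover have "AE x in lebesgue. 0 \<le> - (\<rho> x * \<phi> x)" by (auto simp: \<phi>_def indicator_def)
  ultimately have "AE x in lebesgue. - (\<rho> x * \<phi> x) = 0"
    using integral_nonneg_eq_0_iff_AE[where M = lebesgue and f = "\<lambda>x. - (\<rho> x * \<phi> x)"]
      integral_nonneg_AE[where M = lebesgue and f = "\<lambda>x. - (\<rho> x * \<phi> x)"] by auto
  then have "AE x in lebesgue. 0 \<le> \<rho> x"
    by eventually_elim (auto simp: \<phi>_def indicator_def split: if_splits)
  moreover have "(\<lambda>n. \<integral>x. \<rho>s n x \<partial>lebesgue) \<longlonglongrightarrow> (\<integral>x. \<rho> x \<partial>lebesgue)"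
    using lim[of "\<lambda>x. 1"] by (auto simp: ess_bounded_def)
  then have "(\<integral>x. \<rho> x \<partial>lebesgue) = 1"
    using dens by (simp add: prob_density_def LIMSEQ_const_iff)
  ultimately show ?thesis using int by (simp add: prob_density_def)
qed

text \<open>The function \<open>|b|\<^sup>2\<close> is not an admissible test function, its truncations at height \<open>m\<close> are; they are
integrated by \<open>\<rho>\<close> with a bound independent of \<open>m\<close>, and Fatou's lemma removes the truncation.\<close>

lemma finite_M_b_weak_limit:
  assumes b: "b \<in> borel_measurable borel" and \<rho>s: "\<And>n. \<rho>s n \<in> K b"
    and weak: "weakly_converges_L1 \<rho>s \<rho>" and bdd: "bounded (range (\<lambda>n. M_b b (\<rho>s n)))"
  shows "finite_M_b b \<rho>"
proof -
  have [measurable]: "b \<in> borel_measurable lebesgue" using b by (simp add: measurable_completion)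
  have dens: "prob_density \<rho>"
    using \<rho>s weak by (auto intro: prob_density_weak_limit K_imp_prob_density)
  then have int: "integrable lebesgue \<rho>" and nn: "AE x in lebesgue. 0 \<le> \<rho> x"
    by (auto simp: prob_density_def)
  then have [measurable]: "\<rho> \<in> borel_measurable lebesgue" by auto
  obtain C where C: "\<And>n. M_b b (\<rho>s n) \<le> C"
    using bdd by (auto simp: bounded_real abs_le_iff)
  define g where "g m x = min ((norm (b x))\<^sup>2) (real m)" for m x
  have [measurable]: "g m \<in> borel_measurable lebesgue" for m unfolding g_def by measurable
  have g0: "0 \<le> g m x" for m x by (simp add: g_def)
  have trunc: "(\<integral>\<^sup>+ x. ennreal (\<rho> x * g m x) \<partial>lebesgue) \<le> ennreal C" for m
  proof -
    have "ess_bounded (g m)"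
      unfolding ess_bounded_def by (auto intro!: exI[of _ "real m"] simp: g_def)
    then have "(\<lambda>n. \<integral>x. \<rho>s n x * g m x \<partial>lebesgue) \<longlonglongrightarrow> (\<integral>x. \<rho> x * g m x \<partial>lebesgue)"
      using weak by (auto simp: weakly_converges_L1_def)
    moreover have "(\<integral>x. \<rho>s n x * g m x \<partial>lebesgue) \<le> C" for n
    proof -
      have K: "integrable lebesgue (\<lambda>x. (norm (b x))\<^sup>2 * \<rho>s n x)" "\<And>x. 0 \<le> \<rho>s n x"
        using \<rho>s[of n] by (auto simp: K_def finite_M_b_def)
      have "(\<integral>x. \<rho>s n x * g m x \<partial>lebesgue) \<le> M_b b (\<rho>s n)"
        unfolding M_b_def using K
        by (intro integral_mono_AE') (auto simp: g_def mult.commute[of _ "\<rho>s n _"] intro!: mult_left_mono)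
      with C[of n] show ?thesis by simp
    qed
    ultimately have "(\<integral>x. \<rho> x * g m x \<partial>lebesgue) \<le> C"
      by (intro LIMSEQ_le_const2) auto
    moreover have "integrable lebesgue (\<lambda>x. \<rho> x * g m x)"
    proof (rule Bochner_Integration.integrable_bound)
      show "integrable lebesgue (\<lambda>x. real m * \<rho> x)" using int by simp
      show "AE x in lebesgue. norm (\<rho> x * g m x) \<le> norm (real m * \<rho> x)"
        by (auto simp: abs_mult g_def mult.commute[of "real m"] intro!: mult_left_mono)
    qed measurable
    ultimately show ?thesis
      using nn g0 by (subst nn_integral_eq_integral) (auto intro!: ennreal_leI elim!: eventually_mono)
  qed
  have "(\<integral>\<^sup>+ x. ennreal ((norm (b x))\<^sup>2 * \<rho> x) \<partial>lebesgue) \<le> (\<integral>\<^sup>+ x. liminf (\<lambda>m. ennreal (\<rho> x * g m x)) \<partial>lebesgue)"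
  proof (rule nn_integral_mono)
    fix x
    have "(\<lambda>m. ennreal (\<rho> x * g m x)) \<longlonglongrightarrow> ennreal ((norm (b x))\<^sup>2 * \<rho> x)"
    proof (rule tendsto_eventually, rule eventually_mono[OF eventually_ge_at_top])
      fix m assume "nat \<lceil>(norm (b x))\<^sup>2\<rceil> \<le> m"
      then show "ennreal (\<rho> x * g m x) = ennreal ((norm (b x))\<^sup>2 * \<rho> x)"
        by (simp add: g_def min_def mult.commute nat_ceiling_le_eq)
    qed
    then show "ennreal ((norm (b x))\<^sup>2 * \<rho> x) \<le> liminf (\<lambda>m. ennreal (\<rho> x * g m x))"
      by (simp add: lim_imp_Liminf)
  qed
  also have "\<dots> \<le> liminf (\<lambda>m. \<integral>\<^sup>+ x. ennreal (\<rho> x * g m x) \<partial>lebesgue)"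
    by (rule nn_integral_liminf) measurable
  also have "\<dots> \<le> ennreal C"
    using trunc by (intro Liminf_le always_eventually) auto
  finally have "(\<integral>\<^sup>+ x. ennreal ((norm (b x))\<^sup>2 * \<rho> x) \<partial>lebesgue) < \<top>"
    by (rule le_less_trans) simp
  then show ?thesis
    unfolding finite_M_b_def using nn
    by (intro integrableI_nonneg) (auto elim!: eventually_mono)
qed

lemma smooth_imp_continuous_on: "smooth f \<Longrightarrow> continuous_on UNIV f"
  unfolding smooth_def using C_k.simps(1) by blast

theorem lemma3p6:
  fixes A B :: "real^'d \<Rightarrow> real^'d^'d"
    and b :: "real^'d \<Rightarrow> real^'q"
    and c0 :: real
    and \<rho>s :: "nat \<Rightarrow> real^'d \<Rightarrow> real"
    and \<rho> :: "real^'d \<Rightarrow> real"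
  assumes "CARD('q) \<ge> CARD('d)"
    and "smooth A"
    and "\<And>x. sym_pos_def (A x)"
    and "\<And>x. B x = matrix_inv (A x)"
    and "c0 > 0"
    and "\<And>x v. v \<bullet> (B x *v v) \<ge> c0 * (v \<bullet> v)"
    and "smooth b"
    and "inj b"
    and "b 0 = 0"
    and "\<And>x. B x = transpose (jacobian b (at x)) ** jacobian b (at x)"
    and "\<And>n. \<rho>s n \<in> K b"
    and "weakly_converges_L1 \<rho>s \<rho>"
    and "bounded (range (\<lambda>n. M_b b (\<rho>s n)))"
  shows "finite_M_b b \<rho> \<and>
    (\<forall>\<rho>0 \<in> K b. liminf (\<lambda>n. ereal ((W_A b \<rho>0 (\<rho>s n))\<^sup>2)) \<ge> ereal ((W_A b \<rho>0 \<rho>)\<^sup>2))"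
proof (intro conjI ballI)
  note \<rho>s = \<open>\<And>n. \<rho>s n \<in> K b\<close> and weak = \<open>weakly_converges_L1 \<rho>s \<rho>\<close>
  have b: "continuous_on UNIV b"
    using \<open>smooth b\<close> by (rule smooth_imp_continuous_on)
  then have b_meas: "b \<in> borel_measurable borel"
    by (rule borel_measurable_continuous_onI)
  show "finite_M_b b \<rho>"
    by (rule finite_M_b_weak_limit[OF b_meas \<rho>s weak]) fact
  fix \<rho>0 assume \<rho>0: "\<rho>0 \<in> K b"
  note dens0 = K_imp_prob_density[OF \<rho>0] and dens_s = K_imp_prob_density[OF \<rho>s]
  note dens = prob_density_weak_limit[OF dens_s weak]
  have "\<exists>\<pi>. \<pi> \<in> couplings \<rho>0 (\<rho>s n) \<and>
      (\<forall>\<pi>' \<in> couplings \<rho>0 (\<rho>s n). transport_cost b \<pi> \<le> transport_cost b \<pi>')" for n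
    by (rule optimal_coupling_exists[OF dens0 dens_s[of n] b]) blast
  then obtain \<pi> where \<pi>: "\<And>n. \<pi> n \<in> couplings \<rho>0 (\<rho>s n)"
    and \<pi>_opt: "\<And>n \<pi>'. \<pi>' \<in> couplings \<rho>0 (\<rho>s n) \<Longrightarrow> transport_cost b (\<pi> n) \<le> transport_cost b \<pi>'"
    by metis
  obtain \<sigma> where \<sigma>: "\<sigma> \<in> couplings \<rho>0 \<rho>"
    and \<sigma>_opt: "\<And>\<pi>'. \<pi>' \<in> couplings \<rho>0 \<rho> \<Longrightarrow> transport_cost b \<sigma> \<le> transport_cost b \<pi>'"
    by (rule optimal_coupling_exists[OF dens0 dens b]) blast
  obtain \<gamma> where \<gamma>: "\<gamma> \<in> couplings \<rho>0 \<rho>"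
      "transport_cost b \<gamma> \<le> liminf (\<lambda>n. transport_cost b (\<pi> n))"
    by (rule transport_cost_limit[OF dens0 dens_s dens weak b \<pi>])
  have W_opt: "(W_A b \<rho>0 (\<rho>s n))\<^sup>2 = enn2real (transport_cost b (\<pi> n))" for n
    by (rule W_A_squared[OF \<pi> \<pi>_opt])
  have W_n: "ereal ((W_A b \<rho>0 (\<rho>s n))\<^sup>2) = enn2ereal (transport_cost b (\<pi> n))" for n
    unfolding W_opt
    using transport_cost_finite[OF b_meas \<pi> \<rho>0 \<rho>s, of n]
    by (cases "transport_cost b (\<pi> n)") auto
  \<comment> \<open>For infinite cost the left-hand side is 0 by the convention \<open>enn2real \<top> = 0\<close>.\<close>
  have "ereal ((W_A b \<rho>0 \<rho>)\<^sup>2) \<le> enn2ereal (transport_cost b \<sigma>)"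
  proof -
    have "(W_A b \<rho>0 \<rho>)\<^sup>2 = enn2real (transport_cost b \<sigma>)"
      by (rule W_A_squared[OF \<sigma> \<sigma>_opt])
    then show ?thesis by (cases "transport_cost b \<sigma>") auto
  qed
  also have "\<dots> \<le> enn2ereal (liminf (\<lambda>n. transport_cost b (\<pi> n)))"
    using order_trans[OF \<sigma>_opt[OF \<gamma>(1)] \<gamma>(2)] by (simp add: less_eq_ennreal.rep_eq)
  also have "\<dots> = liminf (\<lambda>n. enn2ereal (transport_cost b (\<pi> n)))"
    by (rule Liminf_compose_continuous_mono[symmetric])
       (auto simp: continuous_on_enn2ereal mono_def less_eq_ennreal.rep_eq)
  finally show "ereal ((W_A b \<rho>0 \<rho>)\<^sup>2) \<le> liminf (\<lambda>n. ereal ((W_A b \<rho>0 (\<rho>s n))\<^sup>2))"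
    by (simp add: W_n)
qed

end
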